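(* For all $k\in\mathbb Z$, $g_k$ is a Pick-function and $\Gamma(g_k(z))=(-1)^{k+1}z$ for all $z\in\mathbb C_+$.
   Context: $\mathbb C_+$ is the open upper half plane. A Pick-function is a holomorphic function $p$ in $\mathbb C_+$ with $\Im p(z)\ge0$ for all $z\in\mathbb C_+$. $\Gamma$ is Euler's gamma function and $\gamma$ Euler's constant. For $k\ge 1$, $x_k$ denotes the unique zero of $\Gamma'$ in $(-k,-k+1)$, and $x_0$ denotes the unique zero of $\Gamma'$ in $(0,\infty)$. The function $\log\Gamma(z)=-\gamma z-\log z-\sum_{j=1}^\infty\left(\log(1+z/j)-z/j\right)$ (principal logarithms) is holomorphic in $\mathbb C\setminus(-\infty,0]$, and it maps $\mathbb C_+$ conformally (bijectively) onto the domain $\mathcal V=\mathbb C\setminus\bigcup_{k=0}^\infty\{x-ik\pi : x\ge\log|\Gamma(x_k)|\}$. $(\log\Gamma)^{-1}:\mathcal V\to\mathbb C_+$ denotes the inverse of this conformal map. For $k\in\mathbb Z$, $g_k(z)=(\log\Gamma)^{-1}(\log z-i(k+1)\pi)$ for $z\in\mathbb C_+$, with $\log$ the principal logarithm. *)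

theory Defs
  imports "HOL-Analysis.Analysis"
begin

definition upper_half_plane :: "complex set" where
  "upper_half_plane = {z. Im z > 0}"

definition pick_function :: "(complex \<Rightarrow> complex) \<Rightarrow> bool" where
  "pick_function p \<longleftrightarrow>
     p holomorphic_on upper_half_plane \<and> (\<forall>z\<in>upper_half_plane. Im (p z) \<ge> 0)"

text \<open>
  The holomorphic logarithm of the Gamma function off the nonpositive real axis is the library's
  \<^term>\<open>ln_Gamma\<close>, which is introduced there as a limit. It is given by the following series.
\<close>

lemma ln_Gamma_eq_series:
  fixes z :: complex
  assumes "z \<notin> \<real>\<^sub>\<le>\<^sub>0"
  shows "summable (\<lambda>n. ln (1 + z / of_nat (Suc n)) - z / of_nat (Suc n))"
    and "ln_Gamma z = - euler_mascheroni * z - ln z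
           - (\<Sum>n. ln (1 + z / of_nat (Suc n)) - z / of_nat (Suc n))"
proof -
  have "z \<notin> \<int>\<^sub>\<le>\<^sub>0"
    using assms nonpos_Ints_subset_nonpos_Reals by blast
  from sums_minus[OF ln_Gamma_series'_aux[OF this]]
  have *: "(\<lambda>n. ln (1 + z / of_nat (Suc n)) - z / of_nat (Suc n)) sums
             - (ln_Gamma z + euler_mascheroni * z + ln z)"
    by simp
  show "summable (\<lambda>n. ln (1 + z / of_nat (Suc n)) - z / of_nat (Suc n))"
    using * by (rule sums_summable)
  show "ln_Gamma z = - euler_mascheroni * z - ln z
          - (\<Sum>n. ln (1 + z / of_nat (Suc n)) - z / of_nat (Suc n))"
    by (subst sums_unique[OF *, symmetric]) simp
qed

text \<open>
  Each of the intervals below contains exactly one zero of the derivative of the real Gamma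
  function, so these descriptions are well defined.
\<close>

definition Gamma_crit :: "nat \<Rightarrow> real" where
  "Gamma_crit k =
     (if k = 0 then THE x. x \<in> {0<..} \<and> deriv Gamma x = 0
      else THE x. x \<in> {- real k <..< - real k + 1} \<and> deriv Gamma x = 0)"

definition slit_domain :: "complex set" where
  "slit_domain = - (\<Union>k. {of_real x - \<i> * of_nat k * of_real pi | x::real.
                         x \<ge> ln \<bar>Gamma (Gamma_crit k)\<bar>})"

text \<open>
  The logarithm of the Gamma function maps the upper half-plane conformally onto the slit domain.
  Its inverse is left unspecified outside the slit domain.
\<close>

definition inv_ln_Gamma :: "complex \<Rightarrow> complex" where
  "inv_ln_Gamma = restrict (the_inv_into upper_half_plane ln_Gamma) slit_domain"

definition g :: "int \<Rightarrow> complex \<Rightarrow> complex" where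
  "g k z = inv_ln_Gamma (ln z - \<i> * (of_int k + 1) * of_real pi)"

end

theory Submission
  imports Defs "HOL-Complex_Analysis.Complex_Analysis"
begin

text \<open>
  The values taken by \<open>ln z - \<i> (k + 1) \<pi>\<close> lie in an open strip between two consecutive lines
  \<open>Im w \<in> \<pi> \<int>\<close>, so only these strips, and not the exact slits, matter. The logarithm of
  Gamma is injective because its derivative maps the upper half-plane into itself. It covers each
  strip because it is open and proper there: it tends to infinity at infinity by the functional
  equation, and at a real boundary point \<open>x\<close> a limit \<open>w\<close> satisfies \<open>exp (- w) = rGamma x\<close>,
  which is real.
\<close>

section \<open>The upper half-plane and the derivative of \<open>ln_Gamma\<close>\<close>

lemma upper_half_plane_iff [simp]: "z \<in> upper_half_plane \<longleftrightarrow> Im z > 0"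
  by (simp add: upper_half_plane_def)

lemma open_upper_half_plane: "open upper_half_plane"
  unfolding upper_half_plane_def by (rule open_halfspace_Im_gt)

lemma convex_upper_half_plane: "convex upper_half_plane"
  unfolding upper_half_plane_def by (rule convex_halfspace_Im_gt)

lemma upper_half_plane_not_nonpos_Reals:
  assumes "Im z > 0"
  shows "z \<notin> \<real>\<^sub>\<le>\<^sub>0" and "z \<notin> \<int>\<^sub>\<le>\<^sub>0"
proof -
  show "z \<notin> \<real>\<^sub>\<le>\<^sub>0"
    using assms by (simp add: complex_nonpos_Reals_iff)
  thus "z \<notin> \<int>\<^sub>\<le>\<^sub>0"
    using nonpos_Ints_subset_nonpos_Reals by blast
qed

text \<open>In the series of \<open>Digamma\<close> the k-th term has imaginary part
  \<open>Im z\<close> over the squared modulus of z + k, which is positive, and Euler's constant is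
  real.\<close>

lemma Im_Digamma_pos:
  assumes "Im z > 0"
  shows "Im (Digamma z) > 0"
proof -
  let ?f = "\<lambda>k. inverse (of_nat (Suc k)) - inverse (z + of_nat k)"
  have Im_f: "Im (?f k) = Im z / (norm (z + of_nat k))\<^sup>2" for k
    by (simp add: cmod_power2 del: of_nat_Suc)
  have "z \<noteq> 0"
    using assms by auto
  hence sm: "summable ?f"
    by (rule summable_Digamma)
  have pos: "Im (?f k) > 0" for k
  proof -
    have "z + of_nat k \<noteq> 0"
      using assms by (auto simp: complex_eq_iff)
    thus ?thesis
      unfolding Im_f using assms by simp
  qed
  have "0 < (\<Sum>k. Im (?f k))"
    using sm pos by (intro suminf_pos summable_Im) auto
  also have "\<dots> = Im (\<Sum>k. ?f k)"
    using sm by (rule Im_suminf[symmetric])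
  finally have "0 < Im (\<Sum>k. ?f k)" .
  moreover have "Im (euler_mascheroni :: complex) = 0"
    by (metis Im_complex_of_real of_real_euler_mascheroni)
  ultimately show ?thesis
    by (simp add: Digamma_def del: of_nat_Suc)
qed

text \<open>
  This is the argument of the Noshiro--Warschawski theorem: on the convex upper half-plane
  the derivative Digamma takes values in an open half-plane.
\<close>

lemma Im_ln_Gamma_slope_pos:
  assumes "Im z > 0" "Im w > 0" "z \<noteq> w"
  shows "Im ((ln_Gamma w - ln_Gamma z) / (w - z)) > 0"
proof -
  define p where "p = (\<lambda>t::real. z + of_real t * (w - z))"
  have p: "Im (p t) > 0" if "0 \<le> t" "t \<le> 1" for t
  proof -
    have "p t = (1 - t) *\<^sub>R z + t *\<^sub>R w"
      by (simp add: p_def scaleR_conv_of_real algebra_simps)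
    thus ?thesis
      using convexD[OF convex_upper_half_plane, of z w "1 - t" t] assms that by simp
  qed
  \<comment> \<open>The chain rule along the segment from z to w produces the factor
    \<open>w - z\<close>, which the division cancels.\<close>
  have deriv: "((\<lambda>s. Im (ln_Gamma (p s) / (w - z))) has_real_derivative Im (Digamma (p t))) (at t)"
    if "0 \<le> t" "t \<le> 1" for t
  proof -
    have "(p has_vector_derivative (w - z)) (at t)"
      unfolding p_def by (auto intro!: derivative_eq_intros)
    moreover have "(ln_Gamma has_field_derivative Digamma (p t)) (at (p t))"
      using p[OF that] by (intro has_field_derivative_ln_Gamma_complex upper_half_plane_not_nonpos_Reals)
    ultimately have "((ln_Gamma \<circ> p) has_vector_derivative ((w - z) * Digamma (p t))) (at t)"
      by (rule field_vector_diff_chain_at)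
    from has_vector_derivative_divide[OF this, of "w - z"]
    have "((\<lambda>s. ln_Gamma (p s) / (w - z)) has_vector_derivative Digamma (p t)) (at t)"
      using assms by (simp add: o_def)
    thus ?thesis
      by (simp add: has_vector_derivative_complex_iff)
  qed
  have "Im (ln_Gamma (p 0) / (w - z)) < Im (ln_Gamma (p 1) / (w - z))"
    by (rule DERIV_pos_imp_increasing[OF zero_less_one]) (use deriv p Im_Digamma_pos in blast)
  thus ?thesis
    by (simp add: p_def diff_divide_distrib)
qed

section \<open>Injectivity and monotonicity of \<open>ln_Gamma\<close>\<close>

lemma inj_on_ln_Gamma: "inj_on ln_Gamma upper_half_plane"
proof (rule inj_onI, rule ccontr)
  fix z w assume "z \<in> upper_half_plane" "w \<in> upper_half_plane" "ln_Gamma z = ln_Gamma w" "z \<noteq> w"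
  with Im_ln_Gamma_slope_pos[of z w] show False
    by simp
qed

text \<open>For a horizontal step the increment is a positive real, so the slope has an imaginary
  part of the same sign as the difference of imaginary parts.\<close>

lemma Im_ln_Gamma_mono:
  assumes "y > 0" "x \<le> x'"
  shows "Im (ln_Gamma (Complex x y)) \<le> Im (ln_Gamma (Complex x' y))"
proof (cases "x = x'")
  case False
  have "Complex x' y - Complex x y = of_real (x' - x)"
    by (simp add: complex_eq_iff)
  with Im_ln_Gamma_slope_pos[of "Complex x y" "Complex x' y"] False assms show ?thesis
    by (simp add: Im_divide_of_real zero_less_divide_iff del: of_real_diff)
qed auto

text \<open>For a vertical step the increment is a positive multiple of \<open>\<i>\<close>, and
  dividing by \<open>\<i>\<close> turns imaginary parts into negated real parts.\<close>

lemma Re_ln_Gamma_antimono: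
  assumes "0 < y" "y \<le> y'"
  shows "Re (ln_Gamma (Complex x y')) \<le> Re (ln_Gamma (Complex x y))"
proof (cases "y = y'")
  case False
  have "Complex x y' - Complex x y = \<i> * of_real (y' - y)"
    by (simp add: complex_eq_iff)
  with Im_ln_Gamma_slope_pos[of "Complex x y" "Complex x y'"] False assms show ?thesis
    by (simp add: Im_divide_of_real divide_less_0_iff del: of_real_diff flip: divide_divide_eq_left)
qed auto

section \<open>The functional equation\<close>

lemma nonpos_Reals_complex_conv: "(\<real>\<^sub>\<le>\<^sub>0 :: complex set) = of_real ` {..0}"
  by (auto simp: nonpos_Reals_def)

text \<open>The recurrence of \<open>Digamma\<close> makes the difference of the two sides constant
  on the connected slit plane, and it vanishes at 1. This excludes any ambiguity by multiples of 2
  pi i.\<close>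

lemma ln_Gamma_complex_plus1:
  assumes "z \<notin> \<real>\<^sub>\<le>\<^sub>0"
  shows "ln_Gamma (z + 1) = ln_Gamma z + Ln z"
proof -
  let ?F = "\<lambda>z. ln_Gamma (z + 1) - ln_Gamma z - Ln z"
  have shift: "z + 1 \<notin> \<real>\<^sub>\<le>\<^sub>0" if "z \<notin> \<real>\<^sub>\<le>\<^sub>0" for z :: complex
    using that by (auto simp: complex_nonpos_Reals_iff)
  have "(?F has_field_derivative 0) (at z)" if "z \<in> - \<real>\<^sub>\<le>\<^sub>0" for z
  proof -
    have "z \<noteq> 0"
      using that by auto
    thus ?thesis
      using that shift[of z] Digamma_plus1[of z]
      by (auto intro!: derivative_eq_intros simp: inverse_eq_divide)
  qed
  moreover have "connected (- \<real>\<^sub>\<le>\<^sub>0 :: complex set)"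
    unfolding nonpos_Reals_complex_conv
    by (intro starlike_imp_connected starlike_slotted_complex_plane_left)
  ultimately have "?F constant_on (- \<real>\<^sub>\<le>\<^sub>0)"
    by (intro has_field_derivative_0_imp_constant_on) (auto simp: closed_nonpos_Reals_complex)
  moreover have "?F 1 = 0"
    using ln_Gamma_complex_of_real[of 1] ln_Gamma_complex_of_real[of 2]
      Gamma_fact[of 1, where 'a = real] by (simp add: ln_Gamma_real_pos)
  ultimately have "?F z = 0"
    using assms unfolding constant_on_def
    by (metis ComplI complex_nonpos_Reals_iff one_complex.sel(1) not_one_le_zero)
  thus ?thesis
    by (simp add: algebra_simps)
qed

section \<open>Growth estimates and properness\<close>

lemma rGamma_eq_exp:
  assumes "Im z > 0"
  shows "rGamma z = exp (- ln_Gamma z)"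
  using upper_half_plane_not_nonpos_Reals(2)[OF assms] by (simp add: rGamma_complex_altdef)

lemma norm_rGamma_eq_exp:
  assumes "Im z > 0"
  shows "norm (rGamma z) = exp (- Re (ln_Gamma z))"
  using assms by (simp add: rGamma_eq_exp)

text \<open>Each term of the series of the imaginary parts is nonnegative, and harmonic sums diverge.\<close>

lemma Im_ln_Gamma_imag_axis_bound:
  obtains C where "\<And>y. y > 0 \<Longrightarrow> Im (ln_Gamma (\<i> * of_real y)) \<ge> y - C"
proof -
  \<comment> \<open>With N terms, the coefficient of y remains at least 1 after Euler's constant is
    subtracted.\<close>
  have "eventually (\<lambda>n. (harm n :: real) \<ge> 1 + euler_mascheroni) sequentially"
    using harm_at_top by (auto simp: filterlim_at_top)
  then obtain N where N: "(harm N :: real) \<ge> 1 + euler_mascheroni"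
    by (auto simp: eventually_at_top_linorder)
  show thesis
  proof (rule that[of "real N * (pi / 2) + pi / 2"])
    fix y :: real assume y: "y > 0"
    define z where "z = \<i> * of_real y"
    let ?t = "\<lambda>k. y / real (Suc k) - arctan (y / real (Suc k))"
    have "z \<notin> \<int>\<^sub>\<le>\<^sub>0"
      using y by (intro upper_half_plane_not_nonpos_Reals) (simp add: z_def)
    from sums_Im[OF ln_Gamma_series'_aux[OF this]]
    have "(\<lambda>k. Im (z / of_nat (Suc k) - ln (1 + z / of_nat (Suc k)))) sums
            Im (ln_Gamma z + euler_mascheroni * z + ln z)" .
    also have "(\<lambda>k. Im (z / of_nat (Suc k) - ln (1 + z / of_nat (Suc k)))) = ?t"
    proof
      fix k
      have "1 + z / of_nat (Suc k) \<noteq> 0" "Re (1 + z / of_nat (Suc k)) = 1"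
           "Im (1 + z / of_nat (Suc k)) = y / real (Suc k)"
        by (auto simp: z_def complex_eq_iff simp del: of_nat_Suc)
      thus "Im (z / of_nat (Suc k) - ln (1 + z / of_nat (Suc k))) = ?t k"
        by (simp add: Im_Ln_eq z_def del: of_nat_Suc)
    qed
    also have "Im (ln_Gamma z + euler_mascheroni * z + ln z) =
               Im (ln_Gamma z) + euler_mascheroni * y + pi / 2"
    proof -
      have "z \<noteq> 0" "0 < Im z \<and> Re z = 0"
        using y by (auto simp: z_def)
      hence "Im (Ln z) = pi / 2"
        by (metis Im_Ln_eq_pi_half(1))
      moreover have "Im (of_real euler_mascheroni * z) = euler_mascheroni * y"
        by (simp add: z_def del: of_real_euler_mascheroni)
      ultimately show ?thesis
        by simp
    qed
    finally have s: "?t sums (Im (ln_Gamma z) + euler_mascheroni * y + pi / 2)" .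
    \<comment> \<open>Each of the first N terms loses at most pi / 2 through its arctangent; the
      remaining terms are nonnegative and are dropped.\<close>
    have "y * harm N - real N * (pi / 2) = (\<Sum>k<N. y / real (Suc k) - pi / 2)"
      unfolding harm_altdef sum_subtractf sum_distrib_left divide_inverse by simp
    also have "\<dots> \<le> (\<Sum>k<N. ?t k)"
      using arctan_ubound by (intro sum_mono diff_left_mono less_imp_le) auto
    also have "\<dots> \<le> (\<Sum>k. ?t k)"
      using s y by (intro sum_le_suminf) (auto simp: sums_iff arctan_le_self simp del: of_nat_Suc)
    also have "\<dots> = Im (ln_Gamma z) + euler_mascheroni * y + pi / 2"
      using s by (simp add: sums_iff)
    finally have "y * harm N - real N * (pi / 2) - euler_mascheroni * y - pi / 2 \<le> Im (ln_Gamma z)"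
      by simp
    moreover have "y * harm N \<ge> y * (1 + euler_mascheroni)"
      using N y by (intro mult_left_mono) auto
    ultimately show "Im (ln_Gamma (\<i> * of_real y)) \<ge> y - (real N * (pi / 2) + pi / 2)"
      by (simp add: z_def algebra_simps)
  qed
qed

text \<open>This bounds the height in the left half-plane when \<open>rGamma\<close> is bounded. In
  the strip from 1 to 3, \<open>norm (rGamma z)\<close> grows with the height, so a minimum at
  height 1 suffices; the equation rGamma z = z * rGamma (z + 1) carries the bound to the
  left.\<close>

lemma norm_rGamma_ge:
  obtains c where "c > 0" "\<And>z. Re z \<le> 2 \<Longrightarrow> Im z \<ge> 1 \<Longrightarrow> norm (rGamma z) \<ge> c * Im z"
proof -
  let ?h = "\<lambda>x. norm (rGamma (Complex x 1))"
  have "continuous_on {1..3} ?h"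
    unfolding Complex_eq
    by (intro continuous_on_norm continuous_on_compose2[OF continuous_on_rGamma[of UNIV]])
       (auto intro!: continuous_intros)
  then obtain x0 where x0: "x0 \<in> {1..3}" "\<And>x. x \<in> {1..3} \<Longrightarrow> ?h x0 \<le> ?h x"
    using continuous_attains_inf[of "{1..3::real}" ?h] by auto
  define c where "c = ?h x0"
  have "c > 0"
    by (simp add: c_def norm_rGamma_eq_exp)
  have strip: "norm (rGamma z) \<ge> c" if "1 \<le> Re z" "Re z \<le> 3" "Im z \<ge> 1" for z
  proof -
    have "c \<le> ?h (Re z)"
      using that x0 by (auto simp: c_def)
    also have "\<dots> \<le> norm (rGamma z)"
      using that Re_ln_Gamma_antimono[of 1 "Im z" "Re z"] by (simp add: norm_rGamma_eq_exp)
    finally show ?thesis .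
  qed
  have rec: "Im z * norm (rGamma (z + 1)) \<le> norm (rGamma z)" for z
  proof -
    have "Im z * norm (rGamma (z + 1)) \<le> norm z * norm (rGamma (z + 1))"
      using abs_Im_le_cmod[of z] by (intro mult_right_mono) auto
    also have "\<dots> = norm (rGamma z)"
      by (subst rGamma_plus1[symmetric]) (simp add: norm_mult)
    finally show ?thesis .
  qed
  have "norm (rGamma z) \<ge> c * Im z" if "- real n \<le> Re z" "Re z \<le> 2" "Im z \<ge> 1" for n z
    using that
  proof (induction n arbitrary: z)
    case 0
    hence "Im z * c \<le> Im z * norm (rGamma (z + 1))"
      by (intro mult_left_mono strip) auto
    thus ?case
      using rec[of z] by (simp add: mult.commute)
  next
    case (Suc n)
    show ?case
    proof (cases "- real n \<le> Re z")
      case True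
      thus ?thesis
        using Suc by blast
    next
      case False
      \<comment> \<open>The linear bound already holds at z + 1, so the new factor only has to be at
        least 1.\<close>
      have "c * Im z \<le> norm (rGamma (z + 1))"
        using Suc.IH[of "z + 1"] Suc.prems False by simp
      also have "\<dots> \<le> Im z * norm (rGamma (z + 1))"
        using Suc.prems by (simp add: mult_le_cancel_right1)
      also note rec[of z]
      finally show ?thesis .
    qed
  qed
  moreover have "\<exists>n. - real n \<le> Re z" for z
    using real_arch_simple[of "- Re z"] by (force simp: minus_le_iff)
  ultimately show thesis
    using that[of c] \<open>c > 0\<close> by blast
qed

text \<open>Starting from a compact box, each unit shift to the right divides \<open>rGamma\<close>
  by z - 1, whose modulus is at least 2.\<close>

lemma norm_rGamma_le:
  obtains M where
    "\<And>n z. real n + 2 \<le> Re z \<Longrightarrow> Re z \<le> real n + 3 \<Longrightarrow> \<bar>Im z\<bar> \<le> Y \<Longrightarrow> norm (rGamma z) \<le> M / 2 ^ n"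
proof -
  have "compact (rGamma ` cbox (Complex 2 (-Y)) (Complex 3 Y))"
    by (intro compact_continuous_image continuous_intros compact_cbox)
  then obtain M where "\<forall>w \<in> rGamma ` cbox (Complex 2 (-Y)) (Complex 3 Y). norm w \<le> M"
    using compact_imp_bounded bounded_iff by metis
  hence M: "norm (rGamma z) \<le> M" if "2 \<le> Re z" "Re z \<le> 3" "\<bar>Im z\<bar> \<le> Y" for z
    using that by (auto simp: in_cbox_complex_iff abs_le_iff)
  have "norm (rGamma z) \<le> M / 2 ^ n"
    if "real n + 2 \<le> Re z" "Re z \<le> real n + 3" "\<bar>Im z\<bar> \<le> Y" for n z
    using that
  proof (induction n arbitrary: z)
    case 0
    thus ?case
      using M[of z] by simp
  next
    case (Suc n)
    have "2 * norm (rGamma z) \<le> norm (z - 1) * norm (rGamma z)"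
      using abs_Re_le_cmod[of "z - 1"] Suc.prems by (intro mult_right_mono) auto
    also have "\<dots> = norm (rGamma (z - 1))"
      using rGamma_plus1[of "z - 1"] by (simp flip: norm_mult)
    also have "\<dots> \<le> M / 2 ^ n"
      using Suc.prems by (intro Suc.IH) auto
    finally show ?case
      by simp
  qed
  thus thesis
    using that by blast
qed

text \<open>By the functional equation each unit step to the left subtracts the argument of a point
  with negative real part, hence at least pi / 2.\<close>

lemma Im_ln_Gamma_le_left:
  assumes "y > 0" "x \<le> - real n"
  shows "Im (ln_Gamma (Complex x y)) \<le> Im (ln_Gamma (Complex 1 y)) - real n * (pi / 2)"
  using assms(2)
proof (induction n arbitrary: x)
  case 0
  thus ?case
    using Im_ln_Gamma_mono[of y x 1] assms(1) by simp
next
  case (Suc n)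
  let ?z = "Complex x y"
  have "ln_Gamma (?z + 1) = ln_Gamma ?z + Ln ?z"
    using assms by (intro ln_Gamma_complex_plus1 upper_half_plane_not_nonpos_Reals) auto
  moreover have "?z + 1 = Complex (x + 1) y"
    by (simp add: complex_eq_iff)
  moreover have "Im (Ln ?z) \<ge> pi / 2"
  proof -
    have "?z \<noteq> 0"
      using assms by (auto simp: complex_eq_iff)
    hence "\<bar>Im (Ln ?z)\<bar> < pi / 2 \<longleftrightarrow> 0 < Re ?z" "0 < Im (Ln ?z)"
      using assms Re_Ln_pos_lt[of ?z] Im_Ln_pos_lt[of ?z] by auto
    thus ?thesis
      using Suc.prems by auto
  qed
  moreover have "Im (ln_Gamma (Complex (x + 1) y)) \<le> Im (ln_Gamma (Complex 1 y)) - real n * (pi / 2)"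
    using Suc.prems by (intro Suc.IH) auto
  ultimately show ?case
    by (simp add: algebra_simps add_divide_distrib)
qed

text \<open>The height is bounded first, separately for \<open>Re z\<close> nonnegative and
  negative. At bounded height, \<open>Im (ln_Gamma z)\<close> tends to minus infinity on the left
  and \<open>rGamma\<close> tends to 0 on the right, which bounds \<open>Re z\<close>.\<close>

lemma ln_Gamma_proper:
  obtains K where "\<And>z. Im z > 0 \<Longrightarrow> norm (ln_Gamma z) \<le> R \<Longrightarrow> norm z \<le> K"
proof -
  obtain C where C: "\<And>y. y > 0 \<Longrightarrow> Im (ln_Gamma (\<i> * of_real y)) \<ge> y - C"
    using Im_ln_Gamma_imag_axis_bound by blast
  obtain c where c: "c > 0" "\<And>z. Re z \<le> 2 \<Longrightarrow> Im z \<ge> 1 \<Longrightarrow> norm (rGamma z) \<ge> c * Im z"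
    using norm_rGamma_ge by blast
  \<comment> \<open>The entry \<open>R + C\<close> serves the right quadrant,
    \<open>exp R / c\<close> the left quadrant above height 1, and 1 the rest.\<close>
  define Y where "Y = max 1 (max (R + C) (exp R / c))"
  obtain M where M: "\<And>n z. real n + 2 \<le> Re z \<Longrightarrow> Re z \<le> real n + 3 \<Longrightarrow> \<bar>Im z\<bar> \<le> Y \<Longrightarrow>
      norm (rGamma z) \<le> M / 2 ^ n"
    using norm_rGamma_le by blast
  \<comment> \<open>On the line of real part 1 the function is continuous down to height 0, so the
    bound is uniform as \<open>Im z\<close> tends to 0.\<close>
  have "compact ((\<lambda>y. Im (ln_Gamma (Complex 1 y))) ` {0..Y})"
    unfolding Complex_eq
    by (intro compact_continuous_image compact_Icc continuous_intros
          continuous_on_compose2[OF continuous_on_ln_Gamma_complex[of "- \<real>\<^sub>\<le>\<^sub>0"]])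
       (auto simp: complex_nonpos_Reals_iff)
  then obtain B where "\<forall>a \<in> (\<lambda>y. Im (ln_Gamma (Complex 1 y))) ` {0..Y}. norm a \<le> B"
    using compact_imp_bounded bounded_iff by metis
  hence B: "Im (ln_Gamma (Complex 1 y)) \<le> B" if "0 \<le> y" "y \<le> Y" for y
    using that by (auto simp: abs_le_iff)
  \<comment> \<open>Left of \<open>- real n1\<close> the imaginary part of \<open>ln_Gamma\<close>
    would drop below \<open>- R\<close>; \<open>n2\<close> makes \<open>M / 2 ^ n2\<close> smaller
    than \<open>exp (- R)\<close>.\<close>
  obtain n1 :: nat where n1: "B + R < real n1 * (pi / 2)"
    using reals_Archimedean3[of "pi / 2"] pi_half_gt_zero by blast
  obtain n2 :: nat where n2: "M * exp R < 2 ^ n2"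
    using real_arch_pow[of 2 "M * exp R"] by auto
  show thesis
  proof (rule that[of "(real n1 + real n2 + 3) + Y"])
    fix z assume z: "Im z > 0" and R: "norm (ln_Gamma z) \<le> R"
    note Re_le = order.trans[OF abs_Re_le_cmod R] and Im_le = order.trans[OF abs_Im_le_cmod R]
    have rG_ge: "norm (rGamma z) \<ge> exp (- R)" and rG_le: "norm (rGamma z) \<le> exp R"
      using Re_le by (auto simp: norm_rGamma_eq_exp z)
    have Im_z: "Im z \<le> Y"
    proof (cases "Re z \<ge> 0")
      case True
      have "Im z - C \<le> Im (ln_Gamma (\<i> * of_real (Im z)))"
        using z by (rule C)
      also have "\<dots> = Im (ln_Gamma (Complex 0 (Im z)))"
        by (simp add: Complex_eq)
      also have "\<dots> \<le> Im (ln_Gamma z)"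
        using Im_ln_Gamma_mono[OF z True] by simp
      finally show ?thesis
        using Im_le by (simp add: Y_def)
    next
      case False
      show ?thesis
      proof (cases "Im z \<ge> 1")
        case True
        hence "c * Im z \<le> exp R"
          using c(2)[of z] False rG_le by simp
        hence "Im z \<le> exp R / c"
          using c(1) by (simp add: field_simps)
        thus ?thesis
          by (simp add: Y_def)
      qed (simp add: Y_def)
    qed
    have "\<not> Re z \<le> - real n1"
    proof
      assume "Re z \<le> - real n1"
      from Im_ln_Gamma_le_left[OF z this] have "Im (ln_Gamma z) \<le> B - real n1 * (pi / 2)"
        using B[of "Im z"] z Im_z by simp
      thus False
        using n1 Im_le by simp
    qed
    moreover have "Re z \<le> real n2 + 3"
    proof (rule ccontr)
      assume *: "\<not> Re z \<le> real n2 + 3"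
      define n where "n = nat \<lfloor>Re z - 2\<rfloor>"
      have n: "real n + 2 \<le> Re z" "Re z \<le> real n + 3" "n2 \<le> n"
        using * by (auto simp: n_def le_nat_floor) linarith+
      have "exp (- R) \<le> M / 2 ^ n"
        using M[OF n(1,2)] z Im_z rG_ge by simp
      hence "2 ^ n \<le> M * exp R"
        by (simp add: exp_minus field_simps)
      moreover have "(2::real) ^ n2 \<le> 2 ^ n"
        using n by simp
      ultimately show False
        using n2 by simp
    qed
    ultimately have "\<bar>Re z\<bar> \<le> real n1 + real n2 + 3"
      by linarith
    thus "norm z \<le> real n1 + real n2 + 3 + Y"
      using cmod_le[of z] z Im_z by linarith
  qed
qed

section \<open>Limits of \<open>ln_Gamma\<close> at the boundary\<close>

lemma Im_eq_multiple_pi: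
  assumes "exp w \<in> \<real>"
  obtains n :: int where "Im w = of_int n * pi"
proof -
  have "sin (Im w) = 0"
    using assms by (simp add: complex_is_Real_iff Im_exp)
  thus thesis
    using that by (auto simp: sin_zero_iff_int2)
qed

lemma between_multiples_pi:
  fixes k j :: int
  assumes "of_int k * pi < x" "x < (of_int k + 1) * pi"
  shows "x \<noteq> of_int j * pi"
proof
  assume "x = of_int j * pi"
  hence "real_of_int k < real_of_int j" "real_of_int j < real_of_int (k + 1)"
    using assms by simp_all
  hence "k < j" "j < k + 1"
    unfolding of_int_less_iff by simp_all
  thus False
    by simp
qed

text \<open>Properness gives a subsequence of z converging to some l in the closed half-plane. A
  real l would make \<open>exp (- w)\<close> real, contrary to the hypothesis on
  \<open>Im w\<close>, so l is interior and continuity applies.\<close>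

lemma ln_Gamma_limit_in_image:
  assumes z: "\<And>n. Im (z n) > 0" and lim: "(\<lambda>n. ln_Gamma (z n)) \<longlonglongrightarrow> w"
    and w: "\<And>k::int. Im w \<noteq> of_int k * pi"
  shows "w \<in> ln_Gamma ` upper_half_plane"
proof -
  obtain R where "\<And>n. norm (ln_Gamma (z n)) \<le> R"
    using convergent_imp_Bseq[OF convergentI[OF lim]] by (auto simp: Bseq_def)
  moreover obtain K where "\<And>z. Im z > 0 \<Longrightarrow> norm (ln_Gamma z) \<le> R \<Longrightarrow> norm z \<le> K"
    using ln_Gamma_proper by blast
  ultimately have "\<And>n. z n \<in> cball 0 K"
    using z by simp
  then obtain l r where l: "l \<in> cball 0 K" "strict_mono r" "(z \<circ> r) \<longlonglongrightarrow> l"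
    using compact_cball[of 0 K] unfolding compact_def by metis
  have lim': "(\<lambda>n. ln_Gamma ((z \<circ> r) n)) \<longlonglongrightarrow> w"
    using LIMSEQ_subseq_LIMSEQ[OF lim l(2)] by (simp add: o_def)
  have "Im l \<ge> 0"
    using z by (intro tendsto_lowerbound[OF tendsto_Im[OF l(3)]]) (auto intro!: always_eventually less_imp_le)
  moreover have "Im l \<noteq> 0"
  proof
    assume "Im l = 0"
    \<comment> \<open>The reciprocal \<open>rGamma\<close> is continuous everywhere, so poles of
      \<open>Gamma\<close> at l need no separate case.\<close>
    have "(\<lambda>n. rGamma ((z \<circ> r) n)) \<longlonglongrightarrow> rGamma l"
      using l(3) by (intro isCont_tendsto_compose[OF isCont_rGamma[OF continuous_ident]])
    moreover have "(\<lambda>n. rGamma ((z \<circ> r) n)) \<longlonglongrightarrow> exp (- w)"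
      using tendsto_exp[OF tendsto_minus[OF lim']] z by (simp add: rGamma_eq_exp)
    ultimately have "exp (- w) = rGamma l"
      by (rule LIMSEQ_unique[symmetric])
    moreover have "rGamma l \<in> \<real>"
      using \<open>Im l = 0\<close> by (intro rGamma_complex_real) (simp add: complex_is_Real_iff)
    ultimately obtain n :: int where "Im (- w) = of_int n * pi"
      using Im_eq_multiple_pi by metis
    thus False
      using w[of "- n"] by simp
  qed
  ultimately have "Im l > 0"
    by simp
  hence "isCont ln_Gamma l"
    by (intro isCont_ln_Gamma_complex upper_half_plane_not_nonpos_Reals) auto
  hence "(\<lambda>n. ln_Gamma ((z \<circ> r) n)) \<longlonglongrightarrow> ln_Gamma l"
    using l(3) isCont_tendsto_compose by blast
  hence "w = ln_Gamma l"
    using lim' LIMSEQ_unique by blast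
  thus ?thesis
    using \<open>Im l > 0\<close> by auto
qed

section \<open>Covering the strips\<close>

lemma holomorphic_on_ln_Gamma: "ln_Gamma holomorphic_on upper_half_plane"
  by (intro holomorphic_ln_Gamma) (use upper_half_plane_not_nonpos_Reals in auto)

text \<open>The imaginary part is unbounded above on the imaginary axis and unbounded below on the
  line of height 1 towards the left; connectedness gives every value between. It ensures that every
  strip meets the image.\<close>

lemma Im_ln_Gamma_surj: "\<exists>z. Im z > 0 \<and> Im (ln_Gamma z) = c"
proof -
  have "continuous_on upper_half_plane (\<lambda>z. Im (ln_Gamma z))"
    using holomorphic_on_ln_Gamma
    by (intro continuous_on_Im) (rule holomorphic_on_imp_continuous_on)
  hence conn: "connected ((\<lambda>z. Im (ln_Gamma z)) ` upper_half_plane)"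
    by (intro connected_continuous_image convex_connected convex_upper_half_plane)
  obtain C where C: "\<And>y. y > 0 \<Longrightarrow> Im (ln_Gamma (\<i> * of_real y)) \<ge> y - C"
    using Im_ln_Gamma_imag_axis_bound by blast
  define y where "y = max 1 (c + C)"
  have le_y: "1 \<le> y" "c + C \<le> y"
    by (simp_all add: y_def)
  have "c \<le> Im (ln_Gamma (\<i> * of_real y))" "Im (\<i> * of_real y) > 0"
    using C[of y] le_y by auto
  moreover obtain n :: nat where "Im (ln_Gamma (Complex 1 1)) - c < real n * (pi / 2)"
    using reals_Archimedean3[of "pi / 2"] pi_half_gt_zero by blast
  hence "Im (ln_Gamma (Complex (- real n) 1)) \<le> c"
    using Im_ln_Gamma_le_left[of 1 "- real n" n] by simp
  moreover have "Im (ln_Gamma (\<i> * of_real y)) \<in> (\<lambda>z. Im (ln_Gamma z)) ` upper_half_plane"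
      "Im (ln_Gamma (Complex (- real n) 1)) \<in> (\<lambda>z. Im (ln_Gamma z)) ` upper_half_plane"
    using le_y by (auto intro!: imageI)
  ultimately have "c \<in> (\<lambda>z. Im (ln_Gamma z)) ` upper_half_plane"
    using connectedD_interval[OF conn] by blast
  thus ?thesis
    by auto
qed

text \<open>The image meets the connected strip in a nonempty set that is relatively open by the
  open mapping theorem and relatively closed because limits inside the strip are attained.\<close>

lemma strip_subset_ln_Gamma_image:
  fixes k :: int
  shows "{w. of_int k * pi < Im w \<and> Im w < (of_int k + 1) * pi} \<subseteq> ln_Gamma ` upper_half_plane"
proof -
  define S where "S = {w. of_int k * pi < Im w \<and> Im w < (of_int k + 1) * pi}"
  let ?V = "ln_Gamma ` upper_half_plane"
  have not_multiple: "Im w \<noteq> of_int j * pi" if "w \<in> S" for w and j :: int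
    using that by (intro between_multiples_pi) (auto simp: S_def)
  have "S = {w. of_int k * pi < Im w} \<inter> {w. Im w < (of_int k + 1) * pi}"
    by (auto simp: S_def)
  hence "convex S"
    by (auto intro!: convex_Int convex_halfspace_Im_gt convex_halfspace_Im_lt)
  hence "connected S"
    by (rule convex_connected)
  moreover have "openin (top_of_set S) (S \<inter> ?V)"
    by (intro openin_open_Int open_mapping_thm3 holomorphic_on_ln_Gamma inj_on_ln_Gamma
        open_upper_half_plane)
  moreover have "S \<inter> ?V = S \<inter> closure ?V"
  proof -
    have "w \<in> ?V" if "w \<in> S" and w_closure: "w \<in> closure ?V" for w
    proof -
      obtain x where x: "\<And>n. x n \<in> ?V" "x \<longlonglongrightarrow> w"
        using w_closure unfolding closure_sequential by blast
      then obtain z where z: "\<And>n. Im (z n) > 0" "\<And>n. x n = ln_Gamma (z n)"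
        unfolding image_iff upper_half_plane_iff Bex_def by metis
      have "x = (\<lambda>n. ln_Gamma (z n))"
        using z(2) by auto
      with x(2) z(1) \<open>w \<in> S\<close> show ?thesis
        using ln_Gamma_limit_in_image[of z w] not_multiple[of w] by blast
    qed
    thus ?thesis
      using closure_subset[of ?V] by blast
  qed
  hence "closedin (top_of_set S) (S \<inter> ?V)"
    unfolding closedin_closed by blast
  moreover have "S \<inter> ?V \<noteq> {}"
  proof -
    \<comment> \<open>The value lies on the middle line of the strip.\<close>
    obtain z where "Im z > 0" "Im (ln_Gamma z) = (of_int k + 1 / 2) * pi"
      using Im_ln_Gamma_surj by blast
    hence "ln_Gamma z \<in> S \<inter> ?V"
      by (auto simp: S_def)
    thus ?thesis
      by blast
  qed
  ultimately have "S \<inter> ?V = S"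
    unfolding connected_clopen by blast
  thus ?thesis
    by (auto simp: S_def)
qed

section \<open>The inverse branches as Pick functions\<close>

theorem proposition3p1:
  fixes k :: int
  shows "pick_function (g k) \<and>
         (\<forall>z\<in>upper_half_plane. Gamma (g k z) = (-1) powi (k + 1) * z)"
proof -
  let ?V = "ln_Gamma ` upper_half_plane"
  define h where "h = the_inv_into upper_half_plane ln_Gamma"
  define q where "q = (\<lambda>z. ln z - \<i> * (of_int k + 1) * of_real pi)"
  \<comment> \<open>The argument of z lies in (0, pi) and is shifted down by (k + 1) pi.\<close>
  have Im_q: "of_int (- k - 1) * pi < Im (q z) \<and> Im (q z) < (of_int (- k - 1) + 1) * pi"
    if "Im z > 0" for z
  proof -
    have "z \<noteq> 0"
      using that by auto
    hence "0 < Im (Ln z)" "Im (Ln z) < pi"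
      using Im_Ln_pos_lt[of z] that by auto
    moreover have "Im (q z) = Im (Ln z) - (of_int k + 1) * pi"
      by (simp add: q_def)
    ultimately show ?thesis
      by (simp add: algebra_simps)
  qed
  have q_V: "q z \<in> ?V" if "Im z > 0" for z
    using strip_subset_ln_Gamma_image[of "- k - 1"] Im_q[OF that] by blast
  \<comment> \<open>This is what allows \<open>inv_ln_Gamma\<close> to be unfolded to the genuine
    inverse. The slits lie on lines of height -n pi, which the strip avoids entirely, whatever their
    endpoints.\<close>
  have q_slit: "q z \<in> slit_domain" if "Im z > 0" for z
  proof -
    have "q z \<noteq> of_real x - \<i> * of_nat n * of_real pi" for n x
      using between_multiples_pi[of "- k - 1" "Im (q z)" "- int n"] Im_q[OF that] by auto
    thus ?thesis
      unfolding slit_domain_def by blast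
  qed
  have g_eq: "g k z = h (q z)" if "Im z > 0" for z
    using q_slit[OF that] by (simp add: g_def inv_ln_Gamma_def h_def q_def)
  have g_upper: "Im (g k z) > 0" if "Im z > 0" for z
    using the_inv_into_into[OF inj_on_ln_Gamma q_V[OF that] order.refl]
    by (simp add: g_eq that h_def)
  have ln_Gamma_g: "ln_Gamma (g k z) = q z" if "Im z > 0" for z
    using f_the_inv_into_f[OF inj_on_ln_Gamma q_V[OF that]] by (simp add: g_eq that h_def)
  \<comment> \<open>The holomorphic inverse h' is identified with \<open>g k\<close> by evaluating
    it at \<open>ln_Gamma (g k z) = q z\<close>.\<close>
  have "\<exists>h'. h' holomorphic_on ?V \<and> (\<forall>z\<in>upper_half_plane. h' (ln_Gamma z) = z)"
    by (rule holomorphic_has_inverse[OF holomorphic_on_ln_Gamma open_upper_half_plane inj_on_ln_Gamma])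
       blast
  then obtain h' where h': "h' holomorphic_on ?V" "\<And>z. z \<in> upper_half_plane \<Longrightarrow> h' (ln_Gamma z) = z"
    by blast
  have "q holomorphic_on upper_half_plane"
    unfolding q_def by (intro holomorphic_intros) (simp add: complex_nonpos_Reals_iff)
  hence "(h' \<circ> q) holomorphic_on upper_half_plane"
    using h'(1) by (rule holomorphic_on_compose_gen) (use q_V in auto)
  moreover have "(h' \<circ> q) z = g k z" if "z \<in> upper_half_plane" for z
    using that h'(2)[of "g k z"] g_upper[of z] ln_Gamma_g[of z] by simp
  ultimately have "g k holomorphic_on upper_half_plane"
    by (rule holomorphic_transform)
  moreover have "Gamma (g k z) = (-1) powi (k + 1) * z" if "Im z > 0" for z
  proof -
    have "z \<noteq> 0"
      using that by auto
    have "exp (\<i> * (of_int k + 1) * of_real pi) = exp (of_int (k + 1) * (\<i> * of_real pi))"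
      by (simp add: mult_ac)
    also have "\<dots> = (exp (\<i> * of_real pi)) powi (k + 1)"
      by (rule exp_power_int[symmetric])
    finally have e: "exp (\<i> * (of_int k + 1) * of_real pi) = (-1) powi (k + 1)"
      by simp
    have "Gamma (g k z) = exp (q z)"
      using g_upper[OF that] upper_half_plane_not_nonpos_Reals[OF g_upper[OF that]]
      by (simp add: Gamma_complex_altdef ln_Gamma_g that)
    also have "\<dots> = z / (-1) powi (k + 1)"
      using \<open>z \<noteq> 0\<close> by (simp add: q_def exp_diff e)
    \<comment> \<open>A power of -1 is its own inverse.\<close>
    also have "\<dots> = (-1) powi (k + 1) * z"
      by (simp add: power_int_minus_left)
    finally show ?thesis .
  qed
  ultimately show ?thesis
    using g_upper by (auto simp: pick_function_def intro: less_imp_le)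
qed

end
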